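(* Let $(\mathcal{N}, c)$ be a subadditive game. If $Semicore(\mathcal{N}, c) = \emptyset$, then $$CoSS(\mathcal{N}, c) \leq \max_{j \in \mathcal{N}} \bigl(c(\mathcal{N}) - c(\mathcal{N} \setminus \{j\})\bigr).$$
   Context: A (cost function, transferable utility) game is a pair $(\mathcal{N}, c)$ where $\mathcal{N} = \{1, \dots, n\}$ is a finite set of players and $c : 2^{\mathcal{N}} \to \mathbb{R}_+$ is a cost function. It is subadditive if $c(S) + c(S') \geq c(S \cup S')$ for all $S, S' \subseteq \mathcal{N}$. For a vector $x = (x_i)_{i \in \mathcal{N}}$ and $S \subseteq \mathcal{N}$, write $x(S) = \sum_{i \in S} x_i$. An outcome of the game is a vector $x = (x_i)_{i \in \mathcal{N}}$ with $x_i \geq 0$ for all $i$ and $x(\mathcal{N}) = c(\mathcal{N})$. The semicore $Semicore(\mathcal{N}, c)$ is the set of outcomes $(x_i)_{i \in \mathcal{N}}$ such that, for all $i \in \mathcal{N}$, $x_i \leq c(\{i\})$ and $x(\mathcal{N} \setminus \{i\}) \leq c(\mathcal{N} \setminus \{i\})$. The cost of semicore stability $CoSS(\mathcal{N}, c)$ is the minimum reduction of the cost of the grand coalition needed to obtain a game with a non-empty semicore, i.e. the optimal value of: minimize $\varepsilon$ subject to $\sum_{i \in \mathcal{N}} x_i = c(\mathcal{N}) - \varepsilon$; $\sum_{j \in \mathcal{N} \setminus \{i\}} x_j \leq c(\mathcal{N} \setminus \{i\})$ for all $i \in \mathcal{N}$; $x_i \leq c(\{i\})$ for all $i \in \mathcal{N}$;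 $x_i \geq 0$ for all $i \in \mathcal{N}$; $\varepsilon \geq 0$. *)

theory Defs
  imports Complex_Main "HOL-Library.FuncSet"
begin

text \<open>
  The value of \<open>c\<close> outside \<open>Pow N\<close> is irrelevant. No normalisation \<open>c {} = 0\<close> is imposed.
\<close>

definition cost_game :: "'a set \<Rightarrow> ('a set \<Rightarrow> real) \<Rightarrow> bool" where
  "cost_game N c \<longleftrightarrow> finite N \<and> N \<noteq> {} \<and> (\<forall>S\<subseteq>N. 0 \<le> c S)"

definition subadditive_game :: "'a set \<Rightarrow> ('a set \<Rightarrow> real) \<Rightarrow> bool" where
  "subadditive_game N c \<longleftrightarrow>
     cost_game N c \<and> (\<forall>S S'. S \<subseteq> N \<longrightarrow> S' \<subseteq> N \<longrightarrow> c S + c S' \<ge> c (S \<union> S'))"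

text \<open>
  Vectors indexed by \<open>N\<close> are functions in \<open>extensional N\<close>, i.e. with a fixed dummy value
  outside \<open>N\<close>.
\<close>

definition outcomes :: "'a set \<Rightarrow> ('a set \<Rightarrow> real) \<Rightarrow> ('a \<Rightarrow> real) set" where
  "outcomes N c = {x \<in> extensional N. (\<forall>i\<in>N. 0 \<le> x i) \<and> sum x N = c N}"

definition Semicore :: "'a set \<Rightarrow> ('a set \<Rightarrow> real) \<Rightarrow> ('a \<Rightarrow> real) set" where
  "Semicore N c =
     {x \<in> outcomes N c. \<forall>i\<in>N. x i \<le> c {i} \<and> sum x (N - {i}) \<le> c (N - {i})}"

definition CoSS_feasible :: "'a set \<Rightarrow> ('a set \<Rightarrow> real) \<Rightarrow> (real \<times> ('a \<Rightarrow> real)) set" where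
  "CoSS_feasible N c =
     {(\<epsilon>, x). x \<in> extensional N \<and>
        sum x N = c N - \<epsilon> \<and>
        (\<forall>i\<in>N. sum x (N - {i}) \<le> c (N - {i})) \<and>
        (\<forall>i\<in>N. x i \<le> c {i}) \<and>
        (\<forall>i\<in>N. 0 \<le> x i) \<and>
        0 \<le> \<epsilon>}"

definition CoSS :: "'a set \<Rightarrow> ('a set \<Rightarrow> real) \<Rightarrow> real" where
  "CoSS N c = (INF (\<epsilon>, x) \<in> CoSS_feasible N c. \<epsilon>)"

text \<open>The infimum defining \<open>CoSS\<close> is over a nonempty set that is bounded below.\<close>

lemma CoSS_feasible_nonempty:
  assumes "cost_game N c"
  shows "CoSS_feasible N c \<noteq> {}"
proof -
  have "(c N, restrict (\<lambda>_. 0) N) \<in> CoSS_feasible N c"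
    using assms by (auto simp: CoSS_feasible_def cost_game_def)
  then show ?thesis by blast
qed

lemma CoSS_feasible_bdd_below:
  "bdd_below ((\<lambda>(\<epsilon>, x). \<epsilon>) ` CoSS_feasible N c)"
  by (rule bdd_belowI[of _ 0]) (auto simp: CoSS_feasible_def)

end

theory Submission
  imports Defs
begin

text \<open>
  If the players together pay a total \<open>T\<close> with \<open>T \<le> c (N - {i})\<close> for every \<open>i\<close>, then each
  coalition \<open>N - {i}\<close> is satisfied no matter how \<open>T\<close> is divided, since payments are
  nonnegative. Only the bounds \<open>0 \<le> x i \<le> c {i}\<close> then matter, and they can be met whenever
  \<open>0 \<le> T \<le> c N\<close>: subadditivity gives \<open>c N \<le> (\<Sum>i\<in>N. c {i})\<close>, so sharing \<open>T\<close> in proportion to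
  the individual costs charges nobody more than \<open>c {i}\<close> (lemma \<open>CoSS_feasible_exists\<close>).

  Let \<open>M\<close> be the maximum of \<open>c N - c (N - {j})\<close>, attained where \<open>c (N - {j})\<close> is smallest.
  The total \<open>T = c N - max 0 M\<close> satisfies all these bounds, so the reduction \<open>max 0 M\<close> is
  feasible. If \<open>M \<le> 0\<close>, the reduction would be \<open>0\<close> and the payments would lie in the semicore;
  hence an empty semicore forces \<open>M > 0\<close>, and \<open>M\<close> itself is feasible.
\<close>

text \<open>
  The bound comes from splitting off one player at a time. It can fail for \<open>S = {}\<close>, because
  \<open>c {}\<close> may be positive.
\<close>

lemma subadditive_game_le_sum_singletons:
  assumes "subadditive_game N c" "S \<subseteq> N" "S \<noteq> {}"
  shows "c S \<le> (\<Sum>i\<in>S. c {i})"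
proof -
  have "finite S"
    using assms(1,2) finite_subset by (auto simp: subadditive_game_def cost_game_def)
  then show ?thesis
    using assms(3,2)
  proof (induction S rule: finite_ne_induct)
    case (singleton i)
    then show ?case by simp
  next
    case (insert i F)
    have "{i} \<subseteq> N" "F \<subseteq> N"
      using insert.prems by auto
    then have "c ({i} \<union> F) \<le> c {i} + c F"
      using assms(1) unfolding subadditive_game_def by metis
    then show ?case
      using insert by simp
  qed
qed

text \<open>
  Payments proportional to the individual costs: the common factor \<open>T / (\<Sum>i\<in>N. c {i})\<close> is
  at most \<open>1\<close>, which yields \<open>x i \<le> c {i}\<close>, and \<open>x (N - {i}) \<le> x N = T\<close>.
\<close>

lemma CoSS_feasible_exists:
  assumes game: "subadditive_game N c"
    and T: "0 \<le> T" "T \<le> c N" "\<And>i. i \<in> N \<Longrightarrow> T \<le> c (N - {i})"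
  shows "\<exists>x. (c N - T, x) \<in> CoSS_feasible N c"
proof -
  define s where "s = (\<Sum>i\<in>N. c {i})"
  define x where "x = restrict (\<lambda>i. T / s * c {i}) N"
  have fin: "finite N" and ne: "N \<noteq> {}" and nonneg: "\<And>i. i \<in> N \<Longrightarrow> 0 \<le> c {i}"
    using game by (auto simp: subadditive_game_def cost_game_def)
  have "T \<le> s"
    using subadditive_game_le_sum_singletons[OF game subset_refl ne] T(2) by (simp add: s_def)
  then have ratio: "0 \<le> T / s" "T / s \<le> 1"
    using T(1) by (auto simp: divide_le_eq_1)
  have x_nonneg: "0 \<le> x i" if "i \<in> N" for i
    using that mult_nonneg_nonneg[OF ratio(1) nonneg] by (simp add: x_def)
  have x_le: "x i \<le> c {i}" if "i \<in> N" for i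
    using that mult_right_mono[OF ratio(2) nonneg] by (simp add: x_def)
  have "sum x N = T / s * s"
    by (simp add: x_def s_def sum_distrib_left)
  \<comment> \<open>If \<open>s = 0\<close>, then \<open>T = 0\<close> as well, and the default \<open>T / 0 = 0\<close> gives the right total.\<close>
  also have "\<dots> = T"
    using T(1) \<open>T \<le> s\<close> by (cases "s = 0") auto
  finally have sum_x: "sum x N = T" .
  have "sum x (N - {i}) \<le> c (N - {i})" if "i \<in> N" for i
  proof -
    have "sum x (N - {i}) \<le> sum x N"
      by (rule sum_mono2) (auto simp: fin x_nonneg)
    then show ?thesis
      using sum_x T(3)[OF that] by simp
  qed
  then have "(c N - T, x) \<in> CoSS_feasible N c"
    using sum_x x_nonneg x_le T(2) by (auto simp: CoSS_feasible_def x_def)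
  then show ?thesis by blast
qed

lemma Semicore_iff_CoSS_feasible_zero:
  "x \<in> Semicore N c \<longleftrightarrow> (0, x) \<in> CoSS_feasible N c"
  by (auto simp: Semicore_def outcomes_def CoSS_feasible_def)

lemma CoSS_le:
  assumes "(\<epsilon>, x) \<in> CoSS_feasible N c"
  shows "CoSS N c \<le> \<epsilon>"
  unfolding CoSS_def
  using cINF_lower[OF CoSS_feasible_bdd_below assms] by simp

theorem theorem4:
  fixes n :: nat and c :: "nat set \<Rightarrow> real" and N :: "nat set"
  defines "N \<equiv> {1..n}"
  assumes "subadditive_game N c"
    and "Semicore N c = {}"
  shows "CoSS N c \<le> (MAX j\<in>N. c N - c (N - {j}))"
proof -
  define M where "M = (MAX j\<in>N. c N - c (N - {j}))"
  have fin: "finite N" and ne: "N \<noteq> {}" and nonneg: "\<And>S. S \<subseteq> N \<Longrightarrow> 0 \<le> c S"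
    using assms(2) by (auto simp: subadditive_game_def cost_game_def)
  have M_ge: "c N - c (N - {j}) \<le> M" if "j \<in> N" for j
    using fin that by (simp add: M_def)
  have M_le: "M \<le> c N"
    using fin ne nonneg by (auto simp: M_def)
  have "\<exists>x. (c N - (c N - max 0 M), x) \<in> CoSS_feasible N c"
  proof (rule CoSS_feasible_exists[OF assms(2)])
    show "0 \<le> c N - max 0 M"
      using M_le nonneg[of N] by simp
    show "c N - max 0 M \<le> c (N - {i})" if "i \<in> N" for i
      using M_ge[OF that] by simp
  qed simp
  then obtain x where x: "(max 0 M, x) \<in> CoSS_feasible N c"
    by auto
  have "0 < M"
  proof (rule ccontr)
    assume "\<not> 0 < M"
    then have "x \<in> Semicore N c"
      using x by (simp add: Semicore_iff_CoSS_feasible_zero max_def split: if_splits)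
    then show False
      using assms(3) by simp
  qed
  then show ?thesis
    using CoSS_le[OF x] by (simp add: M_def)
qed

end
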